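(* For each integer $n\ge 1$ let $\mathbb{P}_n^{*}$ be a probability distribution on $[n]=\{1,\ldots,n\}$, written as $\mathbb{P}_n^{*}(i)=\frac{1}{n}+\varepsilon_{i,n}$ for $i\in[n]$ (so $\sum_{i=1}^n\varepsilon_{i,n}=0$ and $\varepsilon_{i,n}\in[-\tfrac1n,1-\tfrac1n]$). Write $\alpha_n=n^{1/\log\log n}$. Assume: (i) for every $k\ge 1$ and every $k$-tuple $(p_1,\ldots,p_k)$ of distinct primes, $$\lim_{n\to\infty}\sum_{l=1}^{\lfloor n/(p_1\cdots p_k)\rfloor}\varepsilon_{lp_1\cdots p_k,n}=0;$$ (ii) there is a constant $C$ such that for all $n$ (with $\log\log n>0$) and all primes $p>\alpha_n$, $$\sum_{l=1}^{\lfloor n/p\rfloor}\varepsilon_{lp,n}\le \frac{C}{p};$$ (iii) there is a constant $D$ such that for all $n$ (with $\log\log n>0$), all $k\ge1$ and all $k$-tuples $(p_1,\ldots,p_k)$ of distinct primes each at most $\alpha_n$, $$0\le \sum_{l=1}^{\lfloor n/(p_1\cdots p_k)\rfloor}\varepsilon_{lp_1\cdots p_k,n}\le \frac{D}{n}.$$ Then for every real $x$, as $n\to\infty$, $$\mathbb{P}_n^{*}\left(\{m\le n:\ \omega(m)-\log\log n\le x(\log\log n)^{1/2}\}\right)\to \mathbb{P}(Z\le x),$$ where $Z\sim\mathcal{N}(0,1)$.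
   Context: $\omega(m)$ denotes the number of distinct prime factors of the positive integer $m$; $\lfloor\cdot\rfloor$ is the floor function; $\log$ is the natural logarithm. *)

theory Defs
  imports "HOL-Probability.Probability" "HOL-Computational_Algebra.Primes"
begin

definition omega :: "nat \<Rightarrow> nat" where
  "omega m = card (prime_factors m)"

definition alpha :: "nat \<Rightarrow> real" where
  "alpha n = real n powr (1 / ln (ln (real n)))"

definition eps :: "(nat \<Rightarrow> nat \<Rightarrow> real) \<Rightarrow> nat \<Rightarrow> nat \<Rightarrow> real" where
  "eps P n i = P n i - 1 / real n"

end

theory Submission
  imports Defs "HOL-Computational_Algebra.Squarefree" "HOL-Real_Asymp.Real_Asymp"
begin

text \<open>
  Let \<open>L = ln (ln n)\<close> and \<open>z = exp (\<i> t / sqrt L) - 1\<close>. Primes above \<open>alpha n\<close> contribute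
  \<open>o(sqrt L)\<close> to the mean of \<open>omega\<close>, since \<open>\<Sum> 1 / p\<close> over \<open>p \<le> x\<close> is
  \<open>ln (ln x) + o(sqrt (ln (ln x)))\<close>, so they do not affect the limiting characteristic function.
  For the primes up to \<open>alpha n\<close>, expand \<open>(1 + z)\<close> to the power of the number of small prime divisors
  of \<open>m\<close> as \<open>\<Sum> z ^ card T\<close> over the sets \<open>T\<close> of such divisors and cut off at
  \<open>card T < r\<close> with \<open>r\<close> about \<open>L / 2\<close>: the at most \<open>alpha n ^ r \<le> sqrt n\<close> remaining terms
  each have mean \<open>1 / \<Prod>T + O(1 / n)\<close>, and the omitted tail is \<open>O((t * sqrt L) ^ r / r!)\<close>. Hence
  the characteristic function is asymptotic to \<open>\<Prod> (1 + z / p)\<close>, then to the Poisson one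
  \<open>exp (z * \<Sum> 1 / p)\<close>, which after normalisation tends to \<open>exp (- t\<^sup>2 / 2)\<close>. Levy's
  continuity theorem concludes.
\<close>

section \<open>Sums of reciprocals of primes\<close>

text \<open>The cutoff is real because the sum is evaluated at \<open>alpha n\<close>, which need
  not be an integer.\<close>

definition prime_recip_sum :: "real \<Rightarrow> real" where
  "prime_recip_sum x = (\<Sum>p | prime p \<and> real p \<le> x. 1 / real p)"

lemma finite_primes_le: "finite {p::nat. prime p \<and> real p \<le> x}"
proof (rule finite_subset)
  show "{p::nat. prime p \<and> real p \<le> x} \<subseteq> {..nat \<lfloor>x\<rfloor>}"
    by (auto simp: le_nat_floor)
qed auto

text \<open>Comparison with the integral of \<open>x powr (-1-d)\<close> over \<open>[1, N]\<close>.
  The induction keeps the exact value \<open>(1 - N powr (-d)) / d\<close> of that integral, whose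
  increment absorbs each new term.\<close>

lemma sum_powr_le:
  fixes d :: real
  assumes "d > 0"
  shows "(\<Sum>k=1..N. real k powr (-1-d)) \<le> 1 + 1 / d"
proof (cases "N = 0")
  case False
  then have "N \<ge> 1" by simp
  then have "(\<Sum>k=1..N. real k powr (-1-d)) \<le> 1 + (1 - real N powr (-d)) / d"
  proof (induction N rule: dec_induct)
    case base
    then show ?case by simp
  next
    case (step N)
    \<comment> \<open>In terms of \<open>u\<close> the increment inequality is Bernoulli's
      \<open>1 + d * u \<le> (1 - u) powr (-d)\<close>, scaled by
      \<open>real (Suc N) powr (-d)\<close>.\<close>
    define u where "u = 1 / real (Suc N)"
    have u: "0 < u" "u < 1" using step by (auto simp: u_def)
    have N: "real N = real (Suc N) * (1 - u)"
      by (simp add: u_def field_simps)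
    have "d * u \<le> d * (- ln (1 - u))"
      using ln_add_one_self_le_self2[of "-u"] u assms by (intro mult_left_mono) auto
    then have "1 + d * u \<le> exp (- d * ln (1 - u))"
      using exp_ge_add_one_self[of "d * u"] by (smt (verit) exp_le_cancel_iff mult_minus_left mult_minus_right)
    also have "\<dots> = (1 - u) powr (-d)"
      using u by (simp add: powr_def)
    finally have "real (Suc N) powr (-d) * (1 + d * u) \<le> real (Suc N) powr (-d) * (1 - u) powr (-d)"
      by (intro mult_left_mono) auto
    also have "\<dots> = real N powr (-d)"
      unfolding N using u by (subst powr_mult) auto
    finally have *: "real (Suc N) powr (-d) + d * (real (Suc N) powr (-d) * u) \<le> real N powr (-d)"
      by (simp add: algebra_simps)
    have "real (Suc N) powr (-d) * u = real (Suc N) powr (-1-d)"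
      unfolding u_def by (simp add: powr_diff powr_minus field_simps)
    with * have "real (Suc N) powr (-1-d) \<le> (real N powr (-d) - real (Suc N) powr (-d)) / d"
      using assms by (simp add: field_simps)
    with step.IH show ?case
      by (simp add: diff_divide_distrib)
  qed
  also have "\<dots> \<le> 1 + 1 / d"
    using assms by (simp add: divide_right_mono)
  finally show ?thesis .
qed (use assms in auto)

lemma sum_inverse_squares_le: "(\<Sum>k=1..N. 1 / real k ^ 2) \<le> 2"
proof -
  have "(\<Sum>k=1..N. 1 / real k ^ 2) = (\<Sum>k=1..N. real k powr (-1-1))"
    by (intro sum.cong) (auto simp: powr_minus divide_simps)
  then show ?thesis using sum_powr_le[of 1 N] by simp
qed

lemma sum_inverse_squares_primes_le:
  assumes "finite A" "\<And>p. p \<in> A \<Longrightarrow> prime p"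
  shows "(\<Sum>p\<in>A. 1 / real p ^ 2) \<le> 2"
proof -
  have "(\<Sum>p\<in>A. 1 / real p ^ 2) \<le> (\<Sum>k=1..Max (insert 0 A). 1 / real k ^ 2)"
    using assms by (intro sum_mono2) (auto simp: Suc_le_eq prime_gt_0_nat)
  then show ?thesis using sum_inverse_squares_le by (meson order_trans)
qed

lemma prod_one_plus_eq_sum_subsets:
  fixes f :: "'a \<Rightarrow> 'b :: comm_semiring_1"
  assumes "finite A"
  shows "(\<Prod>x\<in>A. 1 + f x) = (\<Sum>S\<in>Pow A. \<Prod>x\<in>S. f x)"
  using prod_add[OF assms, of f "\<lambda>_. 1"] by (simp add: add.commute)

text \<open>
  Every \<open>k \<le> x\<close> is \<open>a * b\<^sup>2\<close> with \<open>a\<close> a product of distinct primes up to \<open>x\<close>, so the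
  harmonic sum is at most \<open>2 * exp (prime_recip_sum x)\<close>.
\<close>

lemma prime_recip_sum_lower:
  assumes "x > 1"
  shows "ln (ln x) - ln 2 \<le> prime_recip_sum x"
proof -
  define N where "N = nat \<lfloor>x\<rfloor>"
  define A where "A = {p::nat. prime p \<and> real p \<le> x}"
  have finA: "finite A" unfolding A_def by (rule finite_primes_le)
  define g where "g = (\<lambda>(S, b). \<Prod>S * b\<^sup>2 :: nat)"
  have "x \<le> real N + 1"
    using assms unfolding N_def by linarith
  then have "ln x \<le> ln (real N + 1)"
    using assms by simp
  also have "\<dots> \<le> (\<Sum>k\<in>{1..N}. 1 / real k)"
    using ln_le_harm[of N] by (simp add: harm_def inverse_eq_divide)
  also have "\<dots> \<le> (\<Sum>k\<in>g ` (Pow A \<times> {1..N}). 1 / real k)"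
  proof (intro sum_mono2)
    show "{1..N} \<subseteq> g ` (Pow A \<times> {1..N})"
    proof
      fix k assume k: "k \<in> {1..N}"
      define a where "a = squarefree_part k"
      define b where "b = square_part k"
      have ab: "k = a * b\<^sup>2"
        unfolding a_def b_def by (rule squarefree_decompose)
      have nz: "a \<noteq> 0" "b \<noteq> 0" using ab k by (auto intro: ccontr)
      have sq: "squarefree a" using k unfolding a_def by auto
      have "a = (\<Prod>p\<in>prime_factors a. p ^ multiplicity p a)"
        using nz by (simp add: prod_prime_factors)
      also have "\<dots> = \<Prod>(prime_factors a)"
        using sq nz squarefree_factorial_semiring'[of a] by (intro prod.cong) auto
      finally have aP: "a = \<Prod>(prime_factors a)" .
      have "prime_factors a \<subseteq> A"
      proof
        fix p assume p: "p \<in> prime_factors a"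
        then have "p dvd k" using ab by (auto simp: in_prime_factors_iff)
        then have "p \<le> N" using k dvd_imp_le[of p k] by auto
        then have "real p \<le> x" using assms unfolding N_def by linarith
        then show "p \<in> A" using p by (auto simp: A_def)
      qed
      moreover have "b \<in> {1..N}"
      proof -
        have "b dvd k" using ab by (simp add: power2_eq_square)
        then have "b \<le> k" using k by (intro dvd_imp_le) auto
        then show ?thesis using nz k by auto
      qed
      ultimately show "k \<in> g ` (Pow A \<times> {1..N})"
        using ab aP unfolding g_def by (intro image_eqI[of _ _ "(prime_factors a, b)"]) auto
    qed
  qed (use finA in auto)
  also have "\<dots> \<le> (\<Sum>z\<in>Pow A \<times> {1..N}. 1 / real (g z))"
    using finA by (intro sum_image_le[of _ "\<lambda>k. 1 / real k" g, unfolded o_def]) auto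
  also have "\<dots> = (\<Sum>S\<in>Pow A. \<Sum>b=1..N. (\<Prod>p\<in>S. 1 / real p) * (1 / real b ^ 2))"
    unfolding sum.cartesian_product
    by (intro sum.cong) (auto simp: g_def prod_dividef)
  also have "\<dots> = (\<Prod>p\<in>A. 1 + 1 / real p) * (\<Sum>b=1..N. 1 / real b ^ 2)"
    unfolding prod_one_plus_eq_sum_subsets[OF finA] by (simp add: sum_product)
  \<comment> \<open>\<open>1 + y \<le> exp y\<close> turns the Euler product into
    \<open>exp (prime_recip_sum x)\<close>. The factor 2 bounds the sum over squares and becomes the
    \<open>ln 2\<close> of the claim.\<close>
  also have "\<dots> \<le> (\<Prod>p\<in>A. exp (1 / real p)) * 2"
    by (intro mult_mono prod_mono sum_inverse_squares_le) (auto intro: sum_nonneg prod_nonneg)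
  also have "\<dots> = 2 * exp (prime_recip_sum x)"
    using exp_sum[OF finA, of "\<lambda>p. 1 / real p"] by (simp add: prime_recip_sum_def A_def)
  finally have "ln x \<le> 2 * exp (prime_recip_sum x)" .
  then have "ln (ln x) \<le> ln (2 * exp (prime_recip_sum x))"
    using assms by (subst ln_le_cancel_iff) auto
  then show ?thesis by (simp add: ln_mult)
qed

text \<open>Unique factorization: \<open>prime_factors\<close> recovers the set from its product.
  Hence an expanded Euler product can be reindexed as a sum over integers without
  repetition.\<close>

lemma inj_on_prod_primes:
  assumes "finite A" "\<And>p. p \<in> A \<Longrightarrow> prime (p::nat)"
  shows "inj_on (\<lambda>S. \<Prod>S) (Pow A)"
proof (rule inj_on_inverseI)
  fix S assume "S \<in> Pow A"
  then have "finite S" "\<And>p. p \<in> S \<Longrightarrow> prime p" using assms finite_subset by auto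
  then show "prime_factors (\<Prod>S) = S"
    by (subst prime_factors_prod) (auto simp: prime_factorization_prime dest: prime_gt_0_nat)
qed

text \<open>
  Rankin's trick: \<open>1 / p \<le> x powr d * p powr (-1-d)\<close> for \<open>p \<le> x\<close>, and the Euler product over
  \<open>1 + p powr (-1-d)\<close> is at most the zeta value at \<open>1 + d\<close>.
\<close>

lemma prime_recip_sum_upper:
  assumes "x \<ge> 1" "d > 0"
  shows "prime_recip_sum x \<le> x powr d * (ln (1 + 1 / d) + 2)"
proof -
  define A where "A = {p::nat. prime p \<and> real p \<le> x}"
  have finA: "finite A" unfolding A_def by (rule finite_primes_le)
  have pA: "prime p" if "p \<in> A" for p using that by (simp add: A_def)
  define f where "f = (\<lambda>p::nat. real p powr (-1-d))"
  have f: "0 < f p" "f p \<le> 1 / real p" "f p \<le> 1" if "p \<in> A" for p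
  proof -
    have p: "real p \<ge> 1" using pA[OF that] by (simp add: Suc_le_eq prime_gt_0_nat)
    then show "0 < f p" by (simp add: f_def)
    have "f p \<le> real p powr (-1)" using p assms unfolding f_def by (intro powr_mono) auto
    also have "\<dots> = 1 / real p" using p by (simp add: powr_minus divide_simps)
    finally show "f p \<le> 1 / real p" .
    also have "\<dots> \<le> 1" using p by simp
    finally show "f p \<le> 1" .
  qed
  let ?I = "(\<lambda>S. \<Prod>S) ` Pow A"
  have I: "k \<in> {1..Max (insert 0 ?I)}" if "k \<in> ?I" for k
  proof -
    have "0 \<notin> A" using pA not_prime_0 by blast
    then have "k \<noteq> 0" using that finite_subset[OF _ finA] by (auto intro!: gr0I)
    moreover have "k \<le> Max (insert 0 ?I)" using that finA by (intro Max_ge) auto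
    ultimately show ?thesis by simp
  qed
  have "(\<Prod>p\<in>A. 1 + f p) = (\<Sum>S\<in>Pow A. f (\<Prod>S))"
    unfolding prod_one_plus_eq_sum_subsets[OF finA] f_def
    by (intro sum.cong refl) (simp add: prod_powr_distrib)
  also have "\<dots> = (\<Sum>k\<in>?I. f k)"
    by (subst sum.reindex[OF inj_on_prod_primes[OF finA pA]]) auto
  also have "\<dots> \<le> (\<Sum>k=1..Max (insert 0 ?I). f k)"
    using I by (intro sum_mono2) (auto simp: f_def)
  also have "\<dots> \<le> 1 + 1 / d"
    unfolding f_def by (rule sum_powr_le) fact
  finally have prod_le: "(\<Prod>p\<in>A. 1 + f p) \<le> 1 + 1 / d" .
  \<comment> \<open>The squares are the price of taking logarithms:
    \<open>ln (1 + y) \<ge> y - y\<^sup>2\<close> with \<open>f p \<le> 1 / p\<close>. Their total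
    is at most 2, which is the summand 2 in the claim.\<close>
  have "(\<Sum>p\<in>A. f p - 1 / real p ^ 2) \<le> (\<Sum>p\<in>A. ln (1 + f p))"
  proof (rule sum_mono)
    fix p assume p: "p \<in> A"
    have "(f p)\<^sup>2 \<le> (1 / real p)\<^sup>2" using f[OF p] by (intro power_mono) auto
    then have "f p - 1 / real p ^ 2 \<le> f p - (f p)\<^sup>2" by (simp add: power_divide)
    also have "\<dots> \<le> ln (1 + f p)" using f[OF p] by (intro ln_one_plus_pos_lower_bound) auto
    finally show "f p - 1 / real p ^ 2 \<le> ln (1 + f p)" .
  qed
  also have "\<dots> = ln (\<Prod>p\<in>A. 1 + f p)"
    using f by (intro ln_prod[symmetric] finA) (smt (verit))
  also have "\<dots> \<le> ln (1 + 1 / d)"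
    using prod_le f assms by (subst ln_le_cancel_iff) (auto intro!: prod_pos add_pos_pos)
  finally have sum_f: "(\<Sum>p\<in>A. f p) \<le> ln (1 + 1 / d) + 2"
    using sum_inverse_squares_primes_le[OF finA pA] by (simp add: sum_subtractf)
  have "prime_recip_sum x = (\<Sum>p\<in>A. 1 / real p)" by (simp add: prime_recip_sum_def A_def)
  also have "\<dots> \<le> (\<Sum>p\<in>A. x powr d * f p)"
  proof (rule sum_mono)
    fix p assume p: "p \<in> A"
    have p1: "real p \<ge> 1" using pA[OF p] by (simp add: Suc_le_eq prime_gt_0_nat)
    have "1 / real p = real p powr d * f p"
      unfolding f_def using p1 by (subst powr_add[symmetric]) (simp add: powr_minus divide_simps)
    also have "\<dots> \<le> x powr d * f p"
      using p p1 f[OF p] assms by (intro mult_right_mono powr_mono2) (auto simp: A_def)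
    finally show "1 / real p \<le> x powr d * f p" .
  qed
  also have "\<dots> \<le> x powr d * (ln (1 + 1 / d) + 2)"
    using sum_f by (simp add: sum_distrib_left[symmetric] mult_left_mono)
  finally show ?thesis .
qed

text \<open>A coarse form of Mertens' second theorem: an error of order
  \<open>ln (ln (ln x))\<close> is good enough, being \<open>o(sqrt (ln (ln x)))\<close>.\<close>

lemma prime_recip_sum_asymp:
  "((\<lambda>x. (prime_recip_sum x - ln (ln x)) / sqrt (ln (ln x))) \<longlongrightarrow> 0) at_top"
proof (rule tendsto_sandwich)
  \<comment> \<open>With this choice the factor \<open>x powr d x = exp (1 / ln (ln x))\<close>
    costs only a bounded amount, while \<open>ln (1 + 1 / d x)\<close> exceeds
    \<open>ln (ln x)\<close> by about \<open>ln (ln (ln x))\<close>.\<close>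
  define d where "d = (\<lambda>x::real. 1 / (ln x * ln (ln x)))"
  show "eventually (\<lambda>x. - ln 2 / sqrt (ln (ln x)) \<le> (prime_recip_sum x - ln (ln x)) / sqrt (ln (ln x))) at_top"
    using eventually_gt_at_top[of "exp 1"]
  proof eventually_elim
    case (elim x)
    have "x > 1" using elim exp_gt_one[of 1] by linarith
    have "ln x > 1" using elim by (smt (verit) exp_gt_zero ln_exp ln_less_cancel_iff)
    then show ?case using prime_recip_sum_lower[OF \<open>x > 1\<close>]
      by (intro divide_right_mono) auto
  qed
  show "eventually (\<lambda>x. (prime_recip_sum x - ln (ln x)) / sqrt (ln (ln x)) \<le>
      (x powr d x * (ln (1 + 1 / d x) + 2) - ln (ln x)) / sqrt (ln (ln x))) at_top"
    using eventually_gt_at_top[of "exp 1"]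
  proof eventually_elim
    case (elim x)
    have "x > 1" using elim exp_gt_one[of 1] by linarith
    have "ln x > 1" using elim by (smt (verit) exp_gt_zero ln_exp ln_less_cancel_iff)
    then have "d x > 0" by (simp add: d_def)
    then show ?case using prime_recip_sum_upper[of x "d x"] \<open>x > 1\<close> \<open>ln x > 1\<close>
      by (intro divide_right_mono) auto
  qed
  show "((\<lambda>x. - ln 2 / sqrt (ln (ln x))) \<longlongrightarrow> 0) at_top" by real_asymp
  show "((\<lambda>x. (x powr d x * (ln (1 + 1 / d x) + 2) - ln (ln x)) / sqrt (ln (ln x))) \<longlongrightarrow> 0) at_top"
    unfolding d_def by real_asymp
qed

section \<open>Elementary symmetric polynomials and truncated products\<close>

text \<open>For finite \<open>A\<close> these are the coefficients of \<open>z ^ k\<close> in the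
  product of \<open>1 + q p * z\<close> over \<open>p \<in> A\<close>.\<close>

definition esym :: "('a \<Rightarrow> real) \<Rightarrow> 'a set \<Rightarrow> nat \<Rightarrow> real" where
  "esym q A k = (\<Sum>T | T \<subseteq> A \<and> card T = k. \<Prod>p\<in>T. q p)"

lemma esym_0: "finite A \<Longrightarrow> esym q A 0 = 1"
proof -
  assume "finite A"
  then have "{T. T \<subseteq> A \<and> card T = 0} = {{}}"
    by (auto dest: finite_subset)
  then show ?thesis by (simp add: esym_def)
qed

lemma esym_empty_Suc: "esym q {} (Suc k) = 0"
proof -
  have "{T. T \<subseteq> {} \<and> card T = Suc k} = {}" by auto
  then show ?thesis unfolding esym_def by (metis sum.empty)
qed

text \<open>Sorts the sets by whether they contain \<open>a\<close>. This recursion drives the two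
  inductions on \<open>A\<close> below.\<close>

lemma esym_insert_Suc:
  assumes "finite A" "a \<notin> A"
  shows "esym q (insert a A) (Suc k) = esym q A (Suc k) + q a * esym q A k"
proof -
  let ?S = "\<lambda>k. {T. T \<subseteq> A \<and> card T = k}"
  have fin: "finite (?S k)" for k
    using assms by (intro finite_subset[of "?S k" "Pow A"]) auto
  have finT: "finite T" "a \<notin> T" if "T \<in> ?S k" for T k
    using that assms finite_subset by auto
  have "{T. T \<subseteq> insert a A \<and> card T = Suc k} = ?S (Suc k) \<union> insert a ` ?S k"
  proof (intro equalityI subsetI)
    fix T assume T: "T \<in> {T. T \<subseteq> insert a A \<and> card T = Suc k}"
    then have "finite T" using assms by (auto intro: finite_subset)
    show "T \<in> ?S (Suc k) \<union> insert a ` ?S k"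
    proof (cases "a \<in> T")
      case True
      then have "T = insert a (T - {a})" "T - {a} \<in> ?S k"
        using T \<open>finite T\<close> by auto
      then show ?thesis by blast
    qed (use T in auto)
  next
    fix T assume "T \<in> ?S (Suc k) \<union> insert a ` ?S k"
    then show "T \<in> {T. T \<subseteq> insert a A \<and> card T = Suc k}"
    proof
      assume "T \<in> insert a ` ?S k"
      then obtain U where "T = insert a U" "U \<in> ?S k" by blast
      with finT[of U k] show ?thesis by auto
    qed auto
  qed
  then have "esym q (insert a A) (Suc k) =
      esym q A (Suc k) + (\<Sum>T\<in>insert a ` ?S k. \<Prod>p\<in>T. q p)"
    unfolding esym_def using fin assms by (subst sum.union_disjoint[symmetric]) auto
  also have "(\<Sum>T\<in>insert a ` ?S k. \<Prod>p\<in>T. q p) = (\<Sum>T\<in>?S k. \<Prod>p\<in>insert a T. q p)"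
  proof (subst sum.reindex)
    show "inj_on (insert a) (?S k)"
      using finT by (intro inj_on_inverseI[where g = "\<lambda>T. T - {a}"]) auto
  qed simp
  also have "\<dots> = q a * esym q A k"
    unfolding esym_def sum_distrib_left by (intro sum.cong refl prod.insert finT)
  finally show ?thesis .
qed

text \<open>In the expansion of the \<open>k\<close>-th power each product over a
  \<open>k\<close>-set occurs \<open>fact k\<close> times, and the other terms are nonnegative. The
  proof is an induction on \<open>A\<close>.\<close>

lemma esym_le:
  assumes "finite A" "\<And>p. p \<in> A \<Longrightarrow> q p \<ge> 0"
  shows "esym q A k \<le> (\<Sum>p\<in>A. q p) ^ k / fact k"
  using assms
proof (induction A arbitrary: k rule: finite_induct)
  case empty
  then show ?case by (cases k) (auto simp: esym_0 esym_empty_Suc)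
next
  case (insert a A)
  define s where "s = (\<Sum>p\<in>A. q p)"
  have s: "s \<ge> 0" using insert unfolding s_def by (intro sum_nonneg) auto
  have q: "q a \<ge> 0" using insert by auto
  have IH: "esym q A k \<le> s ^ k / fact k" for k
    using insert unfolding s_def by auto
  show ?case
  proof (cases k)
    case 0
    then show ?thesis using insert by (simp add: esym_0)
  next
    case (Suc j)
    \<comment> \<open>These are the first two terms of the binomial expansion of
      \<open>(q a + s) ^ Suc j\<close>, which is all that the recursion for \<open>esym\<close>
      produces.\<close>
    have bern: "s ^ Suc j + real (Suc j) * q a * s ^ j \<le> (q a + s) ^ Suc j"
    proof (induction j)
      case (Suc j)
      have "s ^ Suc (Suc j) + real (Suc (Suc j)) * q a * s ^ Suc j
          \<le> (q a + s) * (s ^ Suc j + real (Suc j) * q a * s ^ j)"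
        using s q by (simp add: algebra_simps)
      also have "\<dots> \<le> (q a + s) * (q a + s) ^ Suc j"
        using s q Suc by (intro mult_left_mono) auto
      finally show ?case by simp
    qed simp
    have "esym q (insert a A) k \<le> s ^ Suc j / fact (Suc j) + q a * (s ^ j / fact j)"
      unfolding Suc esym_insert_Suc[OF insert.hyps]
      by (intro add_mono mult_left_mono IH q)
    also have "\<dots> = (s ^ Suc j + real (Suc j) * q a * s ^ j) / fact (Suc j)"
      by (simp add: add_divide_distrib)
    also have "\<dots> \<le> (q a + s) ^ Suc j / fact (Suc j)"
      using bern by (intro divide_right_mono) auto
    finally show ?thesis using insert by (simp add: Suc s_def)
  qed
qed

text \<open>\<open>1 + q * z\<close> is a convex combination of \<open>1\<close> and
  \<open>1 + z\<close>, both in the closed unit disc.\<close>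

lemma norm_one_plus_scaled_le:
  fixes z :: complex
  assumes "norm (1 + z) \<le> 1" "0 \<le> q" "q \<le> 1"
  shows "norm (1 + of_real q * z) \<le> 1"
proof -
  have "1 + of_real q * z = of_real (1 - q) + of_real q * (1 + z)"
    by (simp add: algebra_simps)
  then have "norm (1 + of_real q * z) \<le> norm (of_real (1 - q) :: complex) + norm (of_real q * (1 + z))"
    by (metis norm_triangle_ineq)
  also have "\<dots> \<le> (1 - q) + q * 1"
    using assms by (intro add_mono) (auto simp: norm_mult simp del: of_real_diff intro!: mult_left_le)
  finally show ?thesis by simp
qed

text \<open>
  The factor bound \<open>norm (1 + z) \<le> 1\<close> keeps the remainder at the size of the first omitted term.
  With \<open>q p = 1 / p\<close> this truncates the independent model, and with \<open>q p\<close> the indicator of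
  \<open>p dvd m\<close> it truncates \<open>(1 + z)\<close> to the power of the number of prime divisors of \<open>m\<close> in \<open>A\<close>.
\<close>

lemma prod_one_plus_truncation:
  fixes z :: complex
  assumes "finite A" "\<And>p. p \<in> A \<Longrightarrow> 0 \<le> q p \<and> q p \<le> 1" "norm (1 + z) \<le> 1"
  shows "norm ((\<Prod>p\<in>A. 1 + of_real (q p) * z) - (\<Sum>k<r. of_real (esym q A k) * z ^ k))
           \<le> esym q A r * norm z ^ r"
  using assms(1,2)
proof (induction A arbitrary: r rule: finite_induct)
  case empty
  show ?case
  proof (cases r)
    case (Suc j)
    have "(\<Sum>k<r. of_real (esym q {} k) * z ^ k) = 1"
      unfolding Suc sum.lessThan_Suc_shift by (simp add: esym_0 esym_empty_Suc)
    then show ?thesis by (simp add: Suc esym_empty_Suc)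
  qed (simp add: esym_0)
next
  case (insert a A)
  let ?F = "\<lambda>A r. (\<Prod>p\<in>A. 1 + of_real (q p) * z) - (\<Sum>k<r. of_real (esym q A k) * z ^ k)"
  have q: "0 \<le> q a" "q a \<le> 1" using insert by auto
  show ?case
  proof (cases r)
    case 0
    have "norm (\<Prod>p\<in>insert a A. 1 + of_real (q p) * z) \<le> 1"
      unfolding prod_norm[symmetric] using insert assms(3)
      by (intro prod_le_1) (auto intro!: norm_one_plus_scaled_le)
    then show ?thesis using 0 insert by (simp add: esym_0)
  next
    case (Suc j)
    \<comment> \<open>The error obeys the same recursion in \<open>A\<close> as \<open>esym\<close>,
      so the claimed bound propagates without loss.\<close>
    have F: "?F (insert a A) (Suc j) = ?F A (Suc j) + of_real (q a) * z * ?F A j"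
      unfolding sum.lessThan_Suc_shift using insert
      by (simp add: esym_0 esym_insert_Suc algebra_simps sum.distrib sum_distrib_left)
    have "norm (?F (insert a A) (Suc j)) \<le>
        norm (?F A (Suc j)) + norm (of_real (q a) * z * ?F A j)"
      unfolding F by (rule norm_triangle_ineq)
    also have "\<dots> \<le> esym q A (Suc j) * norm z ^ Suc j + q a * norm z * (esym q A j * norm z ^ j)"
      using insert.IH[of "Suc j"] insert.IH[of j] insert.prems q
      by (intro add_mono) (auto simp: norm_mult intro!: mult_left_mono)
    also have "\<dots> = esym q (insert a A) (Suc j) * norm z ^ Suc j"
      using insert by (simp add: esym_insert_Suc algebra_simps)
    finally show ?thesis by (simp add: Suc)
  qed
qed

text \<open>Distinct primes are coprime, so they all divide \<open>m\<close> exactly when their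
  product does. Averages over \<open>m\<close> thus reduce to masses of the multiples of
  \<open>\<Prod>T\<close>.\<close>

lemma esym_indicator_dvd:
  assumes "finite A" "\<And>p. p \<in> A \<Longrightarrow> prime (p::nat)"
  shows "esym (\<lambda>p. of_bool (p dvd m)) A k =
           (\<Sum>T | T \<subseteq> A \<and> card T = k. of_bool (\<Prod>T dvd m))"
  unfolding esym_def
proof (intro sum.cong refl)
  fix T assume "T \<in> {T. T \<subseteq> A \<and> card T = k}"
  then have T: "finite T" "\<And>p. p \<in> T \<Longrightarrow> prime p"
    using assms finite_subset by auto
  then show "(\<Prod>p\<in>T. of_bool (p dvd m)) = (of_bool (\<Prod>T dvd m) :: real)"
  proof (induction T rule: finite_induct)
    case (insert p T)
    have "coprime p (\<Prod>T)"
      using insert by (intro prod_coprime_right) (auto intro: primes_coprime)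
    then show ?case using insert by (auto simp: divides_mult)
  qed simp
qed

text \<open>\<open>N ^ k \<le> N ^ r\<close> throughout since \<open>N \<ge> 1\<close>, and what
  remains is a partial sum of the series for \<open>exp y\<close>.\<close>

lemma sum_scaled_powers_over_fact_le:
  fixes N y :: real
  assumes "N \<ge> 1" "y \<ge> 0"
  shows "(\<Sum>k\<le>r. (y * N) ^ k / fact k) \<le> N ^ r * exp y"
proof -
  have "(\<Sum>k\<le>r. (y * N) ^ k / fact k) \<le> (\<Sum>k\<le>r. N ^ r * (y ^ k /\<^sub>R fact k))"
  proof (rule sum_mono)
    fix k assume "k \<in> {..r}"
    then have "N ^ k \<le> N ^ r" using assms by (intro power_increasing) auto
    then have "N ^ k * (y ^ k / fact k) \<le> N ^ r * (y ^ k / fact k)"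
      using assms by (intro mult_right_mono) auto
    then show "(y * N) ^ k / fact k \<le> N ^ r * (y ^ k /\<^sub>R fact k)"
      by (simp add: power_mult_distrib field_simps)
  qed
  also have "\<dots> = N ^ r * (\<Sum>k\<le>r. y ^ k /\<^sub>R fact k)" by (simp add: sum_distrib_left)
  also have "\<dots> \<le> N ^ r * exp y"
    unfolding exp_def using assms
    by (intro mult_left_mono sum_le_suminf summable_exp_generic) auto
  finally show ?thesis .
qed

text \<open>Both the weighted average and the product are truncated at degree \<open>r\<close>.
  Their coefficients \<open>c k\<close> and \<open>e k\<close> differ by at most \<open>B\<close>
  for each of the at most \<open>N ^ k / fact k\<close> sets of size \<open>k\<close>; the second
  summand of the bound comes from the two remainders.\<close>

lemma char_dvd_count_approx:
  fixes w :: "nat \<Rightarrow> real" and z :: complex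
  assumes "finite M" "\<And>m. m \<in> M \<Longrightarrow> w m \<ge> 0"
    and A: "finite A" "\<And>p. p \<in> A \<Longrightarrow> prime p" "real (card A) \<le> N" "N \<ge> 1"
    and B: "\<And>T. T \<subseteq> A \<Longrightarrow> \<bar>(\<Sum>m | m \<in> M \<and> \<Prod>T dvd m. w m) - (\<Prod>p\<in>T. 1 / real p)\<bar> \<le> B"
    and z: "norm (1 + z) \<le> 1"
  shows "norm ((\<Sum>m\<in>M. of_real (w m) * (1 + z) ^ card {p\<in>A. p dvd m}) - (\<Prod>p\<in>A. 1 + of_real (1 / real p) * z))
     \<le> B * (N ^ r * exp (norm z)) + 2 * ((norm z * (\<Sum>p\<in>A. 1 / real p)) ^ r / fact r)"
proof -
  define e where "e = (\<lambda>k. esym (\<lambda>p. 1 / real p) A k)"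
  define d where "d = (\<lambda>m. esym (\<lambda>p. of_bool (p dvd m)) A)"
  define c where "c = (\<lambda>k. \<Sum>m\<in>M. w m * d m k)"
  have "B \<ge> 0" using B[of "{}"] by auto
  have c_e: "\<bar>c k - e k\<bar> \<le> B * (N ^ k / fact k)" for k
  proof -
    let ?S = "{T. T \<subseteq> A \<and> card T = k}"
    have "c k = (\<Sum>m\<in>M. \<Sum>T\<in>?S. w m * of_bool (\<Prod>T dvd m))"
      unfolding c_def d_def by (simp add: esym_indicator_dvd[OF A(1,2)] sum_distrib_left)
    also have "\<dots> = (\<Sum>T\<in>?S. \<Sum>m\<in>M. w m * of_bool (\<Prod>T dvd m))"
      by (rule sum.swap)
    also have "\<dots> = (\<Sum>T\<in>?S. \<Sum>m | m \<in> M \<and> \<Prod>T dvd m. w m)"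
      using assms(1) by (intro sum.cong refl sum.mono_neutral_cong_right) auto
    finally have "\<bar>c k - e k\<bar> \<le> (\<Sum>T\<in>?S. \<bar>(\<Sum>m | m \<in> M \<and> \<Prod>T dvd m. w m) - (\<Prod>p\<in>T. 1 / real p)\<bar>)"
      unfolding e_def esym_def by (simp add: sum_subtractf[symmetric] sum_abs)
    also have "\<dots> \<le> (\<Sum>T\<in>?S. B)" by (intro sum_mono B) auto
    also have "\<dots> = B * esym (\<lambda>_. 1) A k" by (simp add: esym_def)
    also have "\<dots> \<le> B * (real (card A) ^ k / fact k)"
      using esym_le[OF A(1), of "\<lambda>_. 1" k] \<open>B \<ge> 0\<close> by (intro mult_left_mono) auto
    also have "\<dots> \<le> B * (N ^ k / fact k)"
      using A \<open>B \<ge> 0\<close> by (intro mult_left_mono divide_right_mono power_mono) auto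
    finally show ?thesis .
  qed
  have e_le: "e r \<le> (\<Sum>p\<in>A. 1 / real p) ^ r / fact r"
    unfolding e_def by (rule esym_le) (use A in auto)
  let ?X = "\<Sum>m\<in>M. of_real (w m) * (1 + z) ^ card {p\<in>A. p dvd m}"
  let ?Y = "\<Prod>p\<in>A. 1 + of_real (1 / real p) * z"
  let ?Sc = "\<Sum>k<r. of_real (c k) * z ^ k" and ?Se = "\<Sum>k<r. of_real (e k) * z ^ k"
  have 1: "norm (?X - ?Sc) \<le> c r * norm z ^ r"
  proof -
    have "?Sc = (\<Sum>k<r. \<Sum>m\<in>M. of_real (w m) * (of_real (d m k) * z ^ k))"
      by (simp add: c_def sum_distrib_right mult.assoc)
    also have "\<dots> = (\<Sum>m\<in>M. of_real (w m) * (\<Sum>k<r. of_real (d m k) * z ^ k))"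
      by (subst sum.swap) (simp add: sum_distrib_left)
    finally have "?X - ?Sc = (\<Sum>m\<in>M. of_real (w m) *
        ((1 + z) ^ card {p\<in>A. p dvd m} - (\<Sum>k<r. of_real (d m k) * z ^ k)))"
      by (simp add: sum_subtractf right_diff_distrib)
    also have "norm \<dots> \<le> (\<Sum>m\<in>M. w m * (d m r * norm z ^ r))"
    proof (rule sum_norm_le)
      fix m assume m: "m \<in> M"
      have "(\<Prod>p\<in>A. 1 + of_real (of_bool (p dvd m)) * z) = (\<Prod>p\<in>{p\<in>A. p dvd m}. 1 + z)"
        using A by (intro prod.mono_neutral_cong_right) auto
      also have "\<dots> = (1 + z) ^ card {p\<in>A. p dvd m}" by simp
      finally have "norm ((1 + z) ^ card {p\<in>A. p dvd m} - (\<Sum>k<r. of_real (d m k) * z ^ k)) \<le> d m r * norm z ^ r"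
        using prod_one_plus_truncation[OF A(1) _ z, of "\<lambda>p. of_bool (p dvd m)" r]
        by (simp add: d_def)
      then show "norm (of_real (w m) * ((1 + z) ^ card {p\<in>A. p dvd m} - (\<Sum>k<r. of_real (d m k) * z ^ k)))
          \<le> w m * (d m r * norm z ^ r)"
        using assms(2)[OF m] by (simp add: norm_mult mult_left_mono)
    qed
    also have "\<dots> = c r * norm z ^ r" by (simp add: c_def sum_distrib_right mult.assoc)
    finally show ?thesis .
  qed
  have 2: "norm (?Y - ?Se) \<le> e r * norm z ^ r"
    unfolding e_def using A(2) prime_gt_0_nat
    by (intro prod_one_plus_truncation A(1) z) (auto simp: Suc_le_eq)
  have 3: "norm (?Sc - ?Se) \<le> (\<Sum>k<r. B * (N ^ k / fact k) * norm z ^ k)"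
  proof -
    have "?Sc - ?Se = (\<Sum>k<r. of_real (c k - e k) * z ^ k)"
      by (simp add: sum_subtractf left_diff_distrib)
    also have "norm \<dots> \<le> (\<Sum>k<r. B * (N ^ k / fact k) * norm z ^ k)"
      by (intro sum_norm_le) (unfold norm_mult norm_power norm_of_real, intro mult_right_mono c_e, simp)
    finally show ?thesis .
  qed
  \<comment> \<open>The remainder of the average is not controlled directly: \<open>c r\<close> is
    replaced by \<open>e r\<close> plus its error. Hence the sum of errors runs up to
    \<open>r\<close> inclusive and \<open>e r\<close> is counted twice.\<close>
  have "c r * norm z ^ r \<le> (e r + B * (N ^ r / fact r)) * norm z ^ r"
    using c_e[of r] by (intro mult_right_mono) auto
  moreover have "norm (?X - ?Y) \<le> norm (?X - ?Sc) + norm (?Y - ?Se) + norm (?Sc - ?Se)"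
    by norm
  ultimately have "norm (?X - ?Y) \<le> (\<Sum>k\<le>r. B * (N ^ k / fact k) * norm z ^ k) + 2 * (e r * norm z ^ r)"
    using 1 2 3 by (simp add: lessThan_Suc_atMost[symmetric] algebra_simps)
  also have "(\<Sum>k\<le>r. B * (N ^ k / fact k) * norm z ^ k) = B * (\<Sum>k\<le>r. (norm z * N) ^ k / fact k)"
    by (simp add: sum_distrib_left power_mult_distrib mult_ac)
  also have "\<dots> \<le> B * (N ^ r * exp (norm z))"
    using A \<open>B \<ge> 0\<close> by (intro mult_left_mono sum_scaled_powers_over_fact_le) auto
  also have "e r * norm z ^ r \<le> (\<Sum>p\<in>A. 1 / real p) ^ r / fact r * norm z ^ r"
    using e_le by (intro mult_right_mono) auto
  finally show ?thesis by (simp add: power_mult_distrib mult_ac)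
qed

section \<open>The Poisson approximation\<close>

text \<open>All factors on both sides lie in the unit disc, so the products differ by at most the
  sum of the factorwise differences. Each of these is \<open>O(norm z ^ 2 / p ^ 2)\<close> by Taylor
  expansion, which is summable over \<open>p\<close>.\<close>

lemma prod_one_plus_prime_recip_approx_exp:
  fixes z :: complex
  assumes A: "finite A" "\<And>p. p \<in> A \<Longrightarrow> prime p" and z: "norm (1 + z) \<le> 1" "norm z \<le> 1"
  shows "norm ((\<Prod>p\<in>A. 1 + of_real (1 / real p) * z) - exp (of_real (\<Sum>p\<in>A. 1 / real p) * z))
           \<le> 2 * exp 1 * norm z ^ 2"
proof -
  \<comment> \<open>\<open>Re z \<le> 0\<close> is what puts the factors \<open>exp (z / p)\<close>
    in the unit disc.\<close>
  have "Re (1 + z) \<le> 1" using z(1) complex_Re_le_cmod order_trans by blast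
  then have Re: "Re z \<le> 0" by simp
  have p1: "real p \<ge> 1" if "p \<in> A" for p
    using A(2)[OF that] by (simp add: Suc_le_eq prime_gt_0_nat)
  have "exp (of_real (\<Sum>p\<in>A. 1 / real p) * z) = (\<Prod>p\<in>A. exp (of_real (1 / real p) * z))"
    by (simp only: exp_sum[OF A(1), symmetric] of_real_sum sum_distrib_right)
  then have "norm ((\<Prod>p\<in>A. 1 + of_real (1 / real p) * z) - exp (of_real (\<Sum>p\<in>A. 1 / real p) * z))
      = norm ((\<Prod>p\<in>A. 1 + of_real (1 / real p) * z) - (\<Prod>p\<in>A. exp (of_real (1 / real p) * z)))"
    by simp
  also have "\<dots> \<le> (\<Sum>p\<in>A. norm (1 + of_real (1 / real p) * z - exp (of_real (1 / real p) * z)))"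
  proof (rule norm_prod_diff)
    fix p assume "p \<in> A"
    then show "norm (1 + of_real (1 / real p) * z) \<le> 1"
      using p1[of p] z by (intro norm_one_plus_scaled_le) auto
    show "norm (exp (of_real (1 / real p) * z)) \<le> 1"
      using p1[of p] Re by (simp add: norm_exp_eq_Re divide_nonpos_nonneg)
  qed
  also have "\<dots> \<le> (\<Sum>p\<in>A. exp 1 * norm z ^ 2 * (1 / real p ^ 2))"
  proof (rule sum_mono)
    fix p assume p: "p \<in> A"
    define w where "w = of_real (1 / real p) * z"
    have nw: "norm w = norm z / real p" using p1[OF p] by (simp add: w_def norm_mult norm_divide)
    have "norm w \<le> 1" using p1[OF p] z unfolding nw by (simp add: divide_le_eq)
    have "norm (1 + w - exp w) = norm (exp w - (\<Sum>i\<le>1. w ^ i / fact i))"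
      by (simp add: norm_minus_commute)
    also have "\<dots> \<le> exp (norm w) * (norm w ^ Suc 1) / fact 1"
      by (rule Taylor_exp_field)
    also have "\<dots> \<le> exp 1 * norm w ^ 2"
      using \<open>norm w \<le> 1\<close> by (simp add: numeral_2_eq_2 mult_right_mono)
    finally show "norm (1 + of_real (1 / real p) * z - exp (of_real (1 / real p) * z))
        \<le> exp 1 * norm z ^ 2 * (1 / real p ^ 2)"
      unfolding w_def[symmetric] by (simp add: nw power_divide)
  qed
  also have "\<dots> = exp 1 * norm z ^ 2 * (\<Sum>p\<in>A. 1 / real p ^ 2)"
    by (simp add: sum_distrib_left)
  also have "\<dots> \<le> exp 1 * norm z ^ 2 * 2"
    by (intro mult_left_mono sum_inverse_squares_primes_le A) auto
  finally show ?thesis by simp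
qed

lemma norm_iexp_minus_one_le: "norm (iexp x - 1) \<le> \<bar>x\<bar>"
  using iexp_approx1[of x 0] by simp

text \<open>For positive \<open>\<mu> n\<close> and \<open>\<nu> n\<close> the left side is the
  characteristic function of a Poisson variable of mean \<open>\<mu> n\<close>, centred at
  \<open>\<nu> n\<close> and scaled by \<open>sqrt (\<nu> n)\<close>.\<close>

lemma poisson_char_tendsto_normal:
  fixes \<mu> \<nu> :: "nat \<Rightarrow> real" and t :: real
  assumes \<nu>: "filterlim \<nu> at_top sequentially"
    and close: "(\<lambda>n. (\<mu> n - \<nu> n) / sqrt (\<nu> n)) \<longlonglongrightarrow> 0"
  shows "(\<lambda>n. iexp (- t * sqrt (\<nu> n)) * exp (of_real (\<mu> n) * (iexp (t / sqrt (\<nu> n)) - 1)))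
           \<longlonglongrightarrow> of_real (exp (- (t ^ 2) / 2))"
proof -
  have pos: "eventually (\<lambda>n. \<nu> n > 0) sequentially"
    using \<nu> by (simp add: filterlim_at_top_dense)
  have sq: "filterlim (\<lambda>n. sqrt (\<nu> n)) at_top sequentially"
    by (rule filterlim_compose[OF sqrt_at_top \<nu>])
  have inv: "(\<lambda>n. 1 / sqrt (\<nu> n)) \<longlonglongrightarrow> 0"
    using tendsto_inverse_0_at_top[OF sq] by (simp add: inverse_eq_divide)
  have "(\<lambda>n. 1 + (\<mu> n - \<nu> n) / sqrt (\<nu> n) * (1 / sqrt (\<nu> n))) \<longlonglongrightarrow> 1 + 0 * 0"
    by (intro tendsto_intros close inv)
  then have ratio: "(\<lambda>n. \<mu> n / \<nu> n) \<longlonglongrightarrow> 1 + 0 * 0"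
  proof (rule Lim_transform_eventually)
    show "\<forall>\<^sub>F n in sequentially. 1 + (\<mu> n - \<nu> n) / sqrt (\<nu> n) * (1 / sqrt (\<nu> n)) = \<mu> n / \<nu> n"
      using pos by eventually_elim (simp add: field_simps)
  qed
  \<comment> \<open>The Taylor remainder satisfies
    \<open>norm (R x) \<le> \<bar>x\<bar> ^ 3 / 6\<close>, so its contribution to the exponent is of
    order \<open>1 / sqrt (\<nu> n)\<close>.\<close>
  define R where "R = (\<lambda>x. iexp x - (\<Sum>k\<le>2. (\<i> * of_real x) ^ k / fact k))"
  \<comment> \<open>The exponent of the left side, sorted by Taylor degree: the linear term cancels
    against the centring up to \<open>\<mu> n - \<nu> n\<close>, and the quadratic one yields the
    Gaussian.\<close>
  define E where "E = (\<lambda>n. of_real (\<mu> n) * R (t / sqrt (\<nu> n))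
      + \<i> * of_real (t * ((\<mu> n - \<nu> n) / sqrt (\<nu> n))) - of_real (t ^ 2 / 2 * (\<mu> n / \<nu> n)))"
  have "(\<lambda>n. of_real (\<mu> n) * R (t / sqrt (\<nu> n))) \<longlonglongrightarrow> 0"
  proof (rule Lim_null_comparison)
    show "\<forall>\<^sub>F n in sequentially. norm (of_real (\<mu> n) * R (t / sqrt (\<nu> n)))
        \<le> \<bar>\<mu> n / \<nu> n\<bar> * (1 / sqrt (\<nu> n)) * (\<bar>t\<bar> ^ 3 / 6)"
      using pos
    proof eventually_elim
      case (elim n)
      have "norm (of_real (\<mu> n) * R (t / sqrt (\<nu> n))) \<le> \<bar>\<mu> n\<bar> * (\<bar>t / sqrt (\<nu> n)\<bar> ^ Suc 2 / fact (Suc 2))"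
        unfolding norm_mult R_def norm_of_real by (intro mult_left_mono iexp_approx1) auto
      also have "\<dots> = \<bar>\<mu> n / \<nu> n\<bar> * (1 / sqrt (\<nu> n)) * (\<bar>t\<bar> ^ 3 / 6)"
        using elim by (simp add: abs_divide power_divide eval_nat_numeral field_simps)
      finally show ?case .
    qed
    have "(\<lambda>n. \<bar>\<mu> n / \<nu> n\<bar> * (1 / sqrt (\<nu> n)) * (\<bar>t\<bar> ^ 3 / 6)) \<longlonglongrightarrow> \<bar>1 + 0 * 0\<bar> * 0 * (\<bar>t\<bar> ^ 3 / 6)"
      by (intro tendsto_intros ratio inv)
    then show "(\<lambda>n. \<bar>\<mu> n / \<nu> n\<bar> * (1 / sqrt (\<nu> n)) * (\<bar>t\<bar> ^ 3 / 6)) \<longlonglongrightarrow> 0" by simp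
  qed
  then have "E \<longlonglongrightarrow> 0 + \<i> * of_real (t * 0) - of_real (t ^ 2 / 2 * (1 + 0 * 0))"
    unfolding E_def by (intro tendsto_intros close ratio)
  then have lim: "(\<lambda>n. exp (E n)) \<longlonglongrightarrow> exp (0 + \<i> * of_real (t * 0) - of_real (t ^ 2 / 2 * (1 + 0 * 0)))"
    by (rule tendsto_exp)
  have val: "exp (0 + \<i> * of_real (t * 0) - of_real (t ^ 2 / 2 * (1 + 0 * 0))) = (of_real (exp (- (t ^ 2) / 2)) :: complex)"
    by (simp add: exp_of_real[symmetric])
  have ev: "\<forall>\<^sub>F n in sequentially. exp (E n) =
      iexp (- t * sqrt (\<nu> n)) * exp (of_real (\<mu> n) * (iexp (t / sqrt (\<nu> n)) - 1))"
    using pos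
  proof eventually_elim
    case (elim n)
    define s where "s = sqrt (\<nu> n)"
    have s: "s > 0" "\<nu> n = s ^ 2" using elim by (auto simp: s_def)
    have "E n = \<i> * of_real (- t * s) + of_real (\<mu> n) * (iexp (t / s) - 1)"
      using s unfolding E_def R_def s_def[symmetric]
      by (simp add: field_simps power2_eq_square eval_nat_numeral)
    then show ?case by (simp only: exp_add s_def)
  qed
  show ?thesis using Lim_transform_eventually[OF lim ev] unfolding val .
qed

section \<open>Asymptotics at the cutoff \<open>alpha n\<close>\<close>

lemma filterlim_lnln_nat: "filterlim (\<lambda>n. ln (ln (real n))) at_top sequentially"
  by real_asymp

lemma filterlim_alpha: "filterlim alpha at_top sequentially"
  unfolding alpha_def by real_asymp

text \<open>For large \<open>n\<close>,
  \<open>ln (ln (alpha n)) = ln (ln n) - ln (ln (ln n))\<close>, so lowering the cutoff from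
  \<open>n\<close> to \<open>alpha n\<close> shifts the main term by only
  \<open>o(sqrt (ln (ln n)))\<close>.\<close>

lemma prime_recip_sum_alpha_asymp:
  "(\<lambda>n. (prime_recip_sum (alpha n) - ln (ln (real n))) / sqrt (ln (ln (real n)))) \<longlonglongrightarrow> 0"
proof -
  let ?L = "\<lambda>x::real. ln (ln x)"
  have 1: "(\<lambda>n. (prime_recip_sum (alpha n) - ?L (alpha n)) / sqrt (?L (alpha n))) \<longlonglongrightarrow> 0"
    by (rule filterlim_compose[OF prime_recip_sum_asymp filterlim_alpha])
  have 2: "(\<lambda>n. sqrt (?L (alpha n)) / sqrt (?L (real n))) \<longlonglongrightarrow> 1"
    unfolding alpha_def by real_asymp
  have 3: "(\<lambda>n. (?L (alpha n) - ?L (real n)) / sqrt (?L (real n))) \<longlonglongrightarrow> 0"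
    unfolding alpha_def by real_asymp
  have pos: "\<forall>\<^sub>F n in sequentially. ?L (alpha n) > 0"
    unfolding alpha_def by real_asymp
  have "(\<lambda>n. (prime_recip_sum (alpha n) - ?L (alpha n)) / sqrt (?L (alpha n)) *
      (sqrt (?L (alpha n)) / sqrt (?L (real n))) + (?L (alpha n) - ?L (real n)) / sqrt (?L (real n)))
      \<longlonglongrightarrow> 0 * 1 + 0"
    by (intro tendsto_intros 1 2 3)
  then have "(\<lambda>n. (prime_recip_sum (alpha n) - ?L (real n)) / sqrt (?L (real n))) \<longlonglongrightarrow> 0 * 1 + 0"
  proof (rule Lim_transform_eventually)
    show "\<forall>\<^sub>F n in sequentially. (prime_recip_sum (alpha n) - ?L (alpha n)) / sqrt (?L (alpha n)) *
      (sqrt (?L (alpha n)) / sqrt (?L (real n))) + (?L (alpha n) - ?L (real n)) / sqrt (?L (real n)) =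
      (prime_recip_sum (alpha n) - ?L (real n)) / sqrt (?L (real n))"
      using pos by eventually_elim (simp add: add_divide_distrib[symmetric])
  qed
  then show ?thesis by simp
qed

lemma prime_recip_sum_above_alpha_asymp:
  "(\<lambda>n. (prime_recip_sum (real n) - prime_recip_sum (alpha n)) / sqrt (ln (ln (real n)))) \<longlonglongrightarrow> 0"
proof -
  have "(\<lambda>n. (prime_recip_sum (real n) - ln (ln (real n))) / sqrt (ln (ln (real n)))) \<longlonglongrightarrow> 0"
    by (rule filterlim_compose[OF prime_recip_sum_asymp filterlim_real_sequentially])
  from tendsto_diff[OF this prime_recip_sum_alpha_asymp] show ?thesis
    by (simp add: diff_divide_distrib[symmetric])
qed

section \<open>Size of the truncation errors\<close>

lemma power_self_over_fact_le: "real r ^ r / fact r \<le> exp (real r)"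
proof -
  have "(\<Sum>k\<in>{r}. real r ^ k /\<^sub>R fact k) \<le> (\<Sum>k. real r ^ k /\<^sub>R fact k)"
    by (intro sum_le_suminf summable_exp_generic) auto
  then show ?thesis by (simp add: exp_def divide_inverse mult.commute)
qed

text \<open>A crude Stirling bound gives \<open>y ^ r / fact r \<le> (exp 1 * y / r) ^ r\<close>,
  and the base becomes small.\<close>

lemma power_over_fact_tendsto_zero:
  fixes y :: "nat \<Rightarrow> real" and r :: "nat \<Rightarrow> nat"
  assumes r: "filterlim r at_top sequentially" and y: "(\<lambda>n. y n / real (r n)) \<longlonglongrightarrow> 0"
    and "\<And>n. y n \<ge> 0"
  shows "(\<lambda>n. y n ^ r n / fact (r n)) \<longlonglongrightarrow> 0"
proof (rule Lim_null_comparison)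
  \<comment> \<open>The constant is chosen so that the factor \<open>exp 1\<close> from
    \<open>power_self_over_fact_le\<close> leaves the base \<open>1 / 2\<close>.\<close>
  have "\<forall>\<^sub>F n in sequentially. y n / real (r n) < 1 / (2 * exp 1)"
    by (rule order_tendstoD[OF y]) simp
  moreover have "\<forall>\<^sub>F n in sequentially. r n \<ge> 1"
    using r by (simp add: filterlim_at_top)
  ultimately show "\<forall>\<^sub>F n in sequentially. norm (y n ^ r n / fact (r n)) \<le> (1 / 2) ^ r n"
  proof eventually_elim
    case (elim n)
    have "y n ^ r n / fact (r n) = (y n / real (r n)) ^ r n * (real (r n) ^ r n / fact (r n))"
      using elim by (simp add: power_divide)
    also have "\<dots> \<le> (1 / (2 * exp 1)) ^ r n * exp (real (r n))"
      using elim assms(3) by (intro mult_mono power_mono power_self_over_fact_le) auto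
    also have "exp (real (r n)) = exp 1 ^ r n"
      using exp_of_nat_mult[of "r n" "1::real"] by simp
    also have "(1 / (2 * exp 1)) ^ r n * exp 1 ^ r n = (1 / 2 :: real) ^ r n"
      by (simp add: power_mult_distrib[symmetric])
    finally show ?case using assms(3) by simp
  qed
  show "(\<lambda>n. (1 / 2 :: real) ^ r n) \<longlonglongrightarrow> 0"
    by (rule filterlim_compose[OF LIMSEQ_power_zero r]) simp
qed

text \<open>\<open>alpha n ^ r = n powr (r / L)\<close> with \<open>L = ln (ln n)\<close> and
  \<open>r \<le> L / 2\<close>. Against an error of order \<open>1 / n\<close> per product of
  primes, this leaves a total of order \<open>1 / sqrt n\<close>.\<close>

lemma alpha_power_le:
  assumes "ln (ln (real n)) > 0" "n \<ge> 1"
  shows "alpha n ^ nat \<lfloor>ln (ln (real n)) / 2\<rfloor> \<le> sqrt (real n)"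
proof -
  let ?L = "ln (ln (real n))" and ?r = "nat \<lfloor>ln (ln (real n)) / 2\<rfloor>"
  have r: "real ?r \<le> ?L / 2" using assms by linarith
  have "alpha n ^ ?r = real n powr (real ?r / ?L)"
    using assms by (simp add: alpha_def powr_realpow[symmetric] powr_powr)
  also have "\<dots> \<le> real n powr (1 / 2)"
    using assms r by (intro powr_mono) (auto simp: divide_simps)
  finally show ?thesis by (simp add: powr_half_sqrt)
qed

text \<open>Translates the hypotheses on \<open>eps\<close> into statements about the mass of the
  multiples of \<open>d\<close>; the uniform part \<open>1 / n\<close> is collected once for each of
  the \<open>n div d\<close> multiples.\<close>

lemma sum_eps_multiples:
  assumes "d > 0"
  shows "(\<Sum>l=1..n div d. eps P n (l * d)) =
    (\<Sum>m | m \<in> {1..n} \<and> d dvd m. P n m) - real (n div d) / real n"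
proof -
  have "(\<Sum>l=1..n div d. P n (l * d)) = (\<Sum>m | m \<in> {1..n} \<and> d dvd m. P n m)"
  proof (rule sum.reindex_bij_witness[of _ "\<lambda>m. m div d" "\<lambda>l. l * d"])
    fix l assume "l \<in> {1..n div d}"
    then show "l * d \<in> {m \<in> {1..n}. d dvd m}"
      using assms by (auto simp: less_eq_div_iff_mult_less_eq Suc_le_eq)
  next
    fix m assume "m \<in> {m \<in> {1..n}. d dvd m}"
    then show "m div d \<in> {1..n div d}"
      using assms by (auto simp: div_le_mono Suc_le_eq div_greater_zero_iff dvd_imp_le)
  qed (use assms in auto)
  then show ?thesis by (simp add: eps_def sum_subtractf)
qed

text \<open>Rounding costs at most \<open>1 / n\<close>, the same order as the error allowed for
  products of small primes.\<close>

lemma div_real_bounds: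
  assumes "d > 0" "n > 0"
  shows "real (n div d) / real n \<le> 1 / real d" "1 / real d - 1 / real n \<le> real (n div d) / real n"
proof -
  have "real (n div d) \<le> real n / real d" by (rule of_nat_div_le_of_nat)
  then show "real (n div d) / real n \<le> 1 / real d" using assms by (simp add: field_simps)
  have "real n / real d - 1 \<le> real (n div d)"
    using floor_divide_of_nat_eq[of n d, where 'a = real] by linarith
  then have "(real n / real d - 1) / real n \<le> real (n div d) / real n"
    by (rule divide_right_mono) simp
  then show "1 / real d - 1 / real n \<le> real (n div d) / real n"
    using assms by (simp add: diff_divide_distrib)
qed

section \<open>Convergence to the normal distribution\<close>

text \<open>Levy's continuity theorem, transferred to finite weighted sums. Since \<open>x\<close>
  carries no mass in \<open>M\<close>, it is a continuity point of the limiting distribution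
  function.\<close>

lemma weighted_cdf_tendsto:
  fixes w f :: "nat \<Rightarrow> nat \<Rightarrow> real"
  assumes w: "\<And>n. n \<ge> 1 \<Longrightarrow> (\<forall>m\<in>{1..n}. w n m \<ge> 0) \<and> (\<Sum>m=1..n. w n m) = 1"
    and M: "real_distribution M" "measure M {x} = 0"
    and char: "\<And>t. (\<lambda>n. \<Sum>m=1..n. of_real (w n m) * iexp (t * f n m)) \<longlonglongrightarrow> char M t"
  shows "(\<lambda>n. \<Sum>m | m \<in> {1..n} \<and> f n m \<le> x. w n m) \<longlonglongrightarrow> measure M {..x}"
proof -
  interpret M: real_distribution M by fact
  \<comment> \<open>The index is \<open>Suc n\<close> because the weights for \<open>0\<close> form
    an empty sum and not a probability distribution; \<open>LIMSEQ_imp_Suc\<close> undoes the shift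
    at the end.\<close>
  define v where "v = (\<lambda>n m. if m \<in> {1..Suc n} then w (Suc n) m else 0)"
  define W where "W = (\<lambda>n. embed_pmf (v n))"
  have v0: "v n m \<ge> 0" for n m using w[of "Suc n"] by (auto simp: v_def)
  have pmf_W: "pmf (W n) m = v n m" for n m
    unfolding W_def
  proof (rule pmf_embed_pmf)
    have "(\<integral>\<^sup>+m. ennreal (v n m) \<partial>count_space UNIV) = (\<Sum>m\<in>{1..Suc n}. ennreal (v n m))"
      by (rule nn_integral_count_space'[of "{1..Suc n}"]) (auto simp: v_def)
    also have "\<dots> = ennreal (\<Sum>m\<in>{1..Suc n}. v n m)"
      using v0 by (intro sum_ennreal) auto
    also have "(\<Sum>m\<in>{1..Suc n}. v n m) = (\<Sum>m\<in>{1..Suc n}. w (Suc n) m)"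
      by (intro sum.cong) (auto simp: v_def)
    also have "\<dots> = 1" using w[of "Suc n"] by simp
    finally show "(\<integral>\<^sup>+m. ennreal (v n m) \<partial>count_space UNIV) = 1" by simp
  qed (rule v0)
  have supp: "m \<in> {1..Suc n}" if "m \<in> set_pmf (W n)" for m n
    using that by (auto simp: set_pmf_iff pmf_W v_def split: if_splits)
  define X where "X = (\<lambda>n. distr (measure_pmf (W n)) borel (f (Suc n)))"
  have X: "real_distribution (X n)" for n
    unfolding X_def by (rule prob_space.real_distribution_distr[OF prob_space_measure_pmf]) simp
  have "char (X n) t = (\<Sum>m=1..Suc n. of_real (w (Suc n) m) * iexp (t * f (Suc n) m))" for n t
  proof -
    have "char (X n) t = (CLINT m|measure_pmf (W n). iexp (t * f (Suc n) m))"
      unfolding char_def X_def by (subst integral_distr) auto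
    also have "\<dots> = (\<Sum>m=1..Suc n. pmf (W n) m *\<^sub>R iexp (t * f (Suc n) m))"
      using supp by (intro integral_measure_pmf) auto
    also have "\<dots> = (\<Sum>m=1..Suc n. of_real (w (Suc n) m) * iexp (t * f (Suc n) m))"
      by (intro sum.cong refl) (simp add: pmf_W v_def scaleR_conv_of_real)
    finally show ?thesis .
  qed
  then have "(\<lambda>n. char (X n) t) \<longlonglongrightarrow> char M t" for t
    using LIMSEQ_Suc[OF char[of t]] by simp
  then have "weak_conv_m X M"
    by (intro levy_continuity X M)
  moreover have "isCont (cdf M) x"
    using M(2) by (simp add: M.isCont_cdf)
  ultimately have "(\<lambda>n. cdf (X n) x) \<longlonglongrightarrow> cdf M x"
    by (auto simp: weak_conv_m_def weak_conv_def)
  moreover have "cdf (X n) x = (\<Sum>m | m \<in> {1..Suc n} \<and> f (Suc n) m \<le> x. w (Suc n) m)" for n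
  proof -
    have "cdf (X n) x = measure (measure_pmf (W n)) {m. f (Suc n) m \<le> x}"
      unfolding cdf_def X_def by (subst measure_distr) (auto simp: vimage_def)
    also have "\<dots> = measure (measure_pmf (W n)) {m \<in> {1..Suc n}. f (Suc n) m \<le> x}"
      using supp by (intro measure_pmf.finite_measure_eq_AE) (auto simp: AE_measure_pmf_iff)
    also have "\<dots> = (\<Sum>m | m \<in> {1..Suc n} \<and> f (Suc n) m \<le> x. pmf (W n) m)"
      by (rule measure_measure_pmf_finite) auto
    also have "\<dots> = (\<Sum>m | m \<in> {1..Suc n} \<and> f (Suc n) m \<le> x. w (Suc n) m)"
      by (intro sum.cong refl) (simp add: pmf_W v_def)
    finally show ?thesis .
  qed
  ultimately show ?thesis
    by (intro LIMSEQ_imp_Suc[of "\<lambda>n. \<Sum>m | m \<in> {1..n} \<and> f n m \<le> x. w n m"]) (simp add: cdf_def)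
qed

lemma measure_std_normal_singleton: "measure std_normal_distribution {x} = 0"
proof -
  have "{x} \<in> null_sets lborel" by (intro null_setsI) auto
  then have "{x} \<in> null_sets std_normal_distribution"
    using absolutely_continuousI_density[of "\<lambda>x. ennreal (std_normal_density x)" lborel]
    unfolding absolutely_continuous_def by auto
  then show ?thesis by (simp add: measure_def null_setsD1)
qed

text \<open>Cutting the second class at \<open>n\<close> loses nothing, since a divisor of
  \<open>m\<close> is at most \<open>m \<le> n\<close>, and it makes the class of large primes
  finite.\<close>

lemma omega_eq_card_split:
  assumes "m \<in> {1..n}"
  shows "omega m = card {p \<in> {p. prime p \<and> real p \<le> a}. p dvd m}
    + card {p \<in> {p. prime p \<and> a < real p \<and> p \<le> n}. p dvd m}"
proof -
  have le_n: "p \<le> n" if "p dvd m" for p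
    using dvd_imp_le[OF that] assms by simp
  have "prime_factors m = {p. prime p \<and> p dvd m}"
    using assms by (auto simp: in_prime_factors_iff)
  also have "\<dots> = {p \<in> {p. prime p \<and> real p \<le> a}. p dvd m}
      \<union> {p \<in> {p. prime p \<and> a < real p \<and> p \<le> n}. p dvd m}"
    using le_n by auto
  finally show ?thesis
    unfolding omega_def
    by (subst card_Un_disjoint[symmetric]) (auto intro: finite_subset[OF _ finite_primes_le[of a]])
qed

text \<open>In the closed unit disc \<open>u ^ b\<close> and \<open>1\<close> differ by at most
  \<open>b * norm (u - 1)\<close>. Averaging \<open>b\<close>, the number of large prime divisors,
  gives the sum of the masses of their multiples.\<close>

lemma char_omega_drop_large_primes:
  fixes w :: "nat \<Rightarrow> real" and z :: complex
  assumes w: "\<And>m. m \<in> {1..n} \<Longrightarrow> w m \<ge> 0" and z: "norm (1 + z) \<le> 1"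
  shows "norm ((\<Sum>m=1..n. of_real (w m) * (1 + z) ^ omega m)
      - (\<Sum>m=1..n. of_real (w m) * (1 + z) ^ card {p \<in> {p. prime p \<and> real p \<le> a}. p dvd m}))
    \<le> norm z * (\<Sum>p | prime p \<and> a < real p \<and> p \<le> n. \<Sum>m | m \<in> {1..n} \<and> p dvd m. w m)"
proof -
  let ?A = "{p. prime p \<and> real p \<le> a}" and ?B = "{p. prime p \<and> a < real p \<and> p \<le> n}"
  have finB: "finite ?B" by (rule finite_subset[of _ "{..n}"]) auto
  have "(\<Sum>m=1..n. of_real (w m) * (1 + z) ^ omega m)
      - (\<Sum>m=1..n. of_real (w m) * (1 + z) ^ card {p \<in> ?A. p dvd m})
      = (\<Sum>m=1..n. of_real (w m) * ((1 + z) ^ omega m - (1 + z) ^ card {p \<in> ?A. p dvd m}))"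
    by (simp add: sum_subtractf right_diff_distrib)
  also have "norm \<dots> \<le> (\<Sum>m=1..n. w m * (norm z * (\<Sum>p\<in>?B. of_bool (p dvd m))))"
  proof (rule sum_norm_le)
    fix m assume m: "m \<in> {1..n}"
    let ?b = "card {p \<in> ?B. p dvd m}"
    let ?a = "card {p \<in> ?A. p dvd m}"
    have split: "(1 + z) ^ omega m - (1 + z) ^ ?a = (1 + z) ^ ?a * ((1 + z) ^ ?b - 1 ^ ?b)"
      by (simp add: omega_eq_card_split[OF m, of a] power_add algebra_simps)
    have "norm ((1 + z) ^ omega m - (1 + z) ^ ?a) \<le> 1 * (real ?b * norm ((1 + z) - 1))"
      unfolding split norm_mult norm_power
    proof (rule mult_mono)
      show "norm ((1 + z) ^ ?b - 1 ^ ?b) \<le> real ?b * norm ((1 + z) - 1)"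
        by (rule norm_power_diff[OF z]) simp
      show "norm (1 + z) ^ ?a \<le> 1"
        by (rule power_le_one[OF norm_ge_zero z])
    qed simp_all
    moreover have "real ?b = (\<Sum>p\<in>?B. of_bool (p dvd m))"
    proof -
      have "(\<Sum>p\<in>?B. of_bool (p dvd m) :: real) = (\<Sum>p\<in>{p \<in> ?B. p dvd m}. 1)"
        using finB by (intro sum.mono_neutral_cong_right) auto
      then show ?thesis by simp
    qed
    ultimately have "norm ((1 + z) ^ omega m - (1 + z) ^ ?a) \<le> norm z * (\<Sum>p\<in>?B. of_bool (p dvd m))"
      by (simp only: mult_1 add_diff_cancel_left' mult.commute)
    then show "norm (of_real (w m) * ((1 + z) ^ omega m - (1 + z) ^ card {p \<in> ?A. p dvd m}))
        \<le> w m * (norm z * (\<Sum>p\<in>?B. of_bool (p dvd m)))"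
      unfolding norm_mult norm_of_real using w[OF m] by (simp only: abs_of_nonneg mult_left_mono)
  qed
  also have "\<dots> = norm z * (\<Sum>m=1..n. \<Sum>p\<in>?B. w m * of_bool (p dvd m))"
    by (simp only: sum_distrib_left mult_ac)
  also have "(\<Sum>m=1..n. \<Sum>p\<in>?B. w m * of_bool (p dvd m)) = (\<Sum>p\<in>?B. \<Sum>m=1..n. w m * of_bool (p dvd m))"
    by (rule sum.swap)
  also have "\<dots> = (\<Sum>p\<in>?B. \<Sum>m | m \<in> {1..n} \<and> p dvd m. w m)"
    by (intro sum.cong refl sum.mono_neutral_cong_right) auto
  finally show ?thesis .
qed

lemma card_primes_le:
  assumes "x \<ge> 0"
  shows "real (card {p::nat. prime p \<and> real p \<le> x}) \<le> x"
proof -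
  have "card {p::nat. prime p \<and> real p \<le> x} \<le> card {1..nat \<lfloor>x\<rfloor>}"
    by (intro card_mono) (auto simp: le_nat_floor Suc_le_eq prime_gt_0_nat)
  also have "real \<dots> \<le> x" using assms by simp
  finally show ?thesis by simp
qed

lemma prime_recip_sum_diff:
  assumes "a \<le> real n"
  shows "(\<Sum>p | prime p \<and> a < real p \<and> p \<le> n. 1 / real p) = prime_recip_sum (real n) - prime_recip_sum a"
proof -
  have B: "{p. prime p \<and> a < real p \<and> p \<le> n} =
      {p. prime p \<and> real p \<le> real n} - {p. prime p \<and> real p \<le> a}"
    by auto
  show ?thesis
    unfolding prime_recip_sum_def B using assms by (intro sum_diff finite_primes_le) auto
qed

text \<open>Compares in turn \<open>X\<close>, \<open>Y\<close>, \<open>Q\<close>, \<open>U\<close>: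
  all primes, primes up to \<open>alpha n\<close>, the independent model, the Poisson model. The
  centring factor enters only at the end; having modulus 1, it does not affect the errors.\<close>

lemma omega_char_tendsto:
  fixes P :: "nat \<Rightarrow> nat \<Rightarrow> real" and C D t :: real
  assumes distr: "\<And>n. n \<ge> 1 \<Longrightarrow> (\<forall>i\<in>{1..n}. P n i \<ge> 0) \<and> (\<Sum>i=1..n. P n i) = 1"
    and large: "\<And>n p. ln (ln (real n)) > 0 \<Longrightarrow> prime p \<Longrightarrow> real p > alpha n \<Longrightarrow>
        (\<Sum>l=1..n div p. eps P n (l * p)) \<le> C / real p"
    and small: "\<And>n S. ln (ln (real n)) > 0 \<Longrightarrow> finite S \<Longrightarrow> S \<noteq> {} \<Longrightarrow>
        (\<forall>p\<in>S. prime p \<and> real p \<le> alpha n) \<Longrightarrow>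
        0 \<le> (\<Sum>l=1..n div (\<Prod>S). eps P n (l * \<Prod>S)) \<and>
        (\<Sum>l=1..n div (\<Prod>S). eps P n (l * \<Prod>S)) \<le> D / real n"
  shows "(\<lambda>n. \<Sum>m=1..n. of_real (P n m) *
            iexp (t * ((real (omega m) - ln (ln (real n))) / sqrt (ln (ln (real n))))))
          \<longlonglongrightarrow> of_real (exp (- (t ^ 2) / 2))"
proof -
  define L where "L = (\<lambda>n. ln (ln (real n)))"
  define z where "z = (\<lambda>n. iexp (t / sqrt (L n)) - 1)"
  define A where "A = (\<lambda>n. {p::nat. prime p \<and> real p \<le> alpha n})"
  define \<mu> where "\<mu> = (\<lambda>n. prime_recip_sum (alpha n))"
  \<comment> \<open>with this truncation order, \<open>alpha n ^ r n \<le> sqrt n\<close>, while \<open>r n\<close> still outgrows \<open>sqrt (L n)\<close>\<close>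
  define r where "r = (\<lambda>n. nat \<lfloor>L n / 2\<rfloor>)"
  define X where "X = (\<lambda>n. \<Sum>m=1..n. of_real (P n m) * (1 + z n) ^ omega m)"
  define Y where "Y = (\<lambda>n. \<Sum>m=1..n. of_real (P n m) * (1 + z n) ^ card {p \<in> A n. p dvd m})"
  define Q where "Q = (\<lambda>n. \<Prod>p\<in>A n. 1 + of_real (1 / real p) * z n)"
  define U where "U = (\<lambda>n. exp (of_real (\<mu> n) * z n))"

  have L_lim: "filterlim L at_top sequentially"
    unfolding L_def by (rule filterlim_lnln_nat)
  have L_pos: "\<forall>\<^sub>F n in sequentially. L n > 0"
    using L_lim by (simp add: filterlim_at_top_dense)
  have n_pos: "n \<ge> 1" if "L n > 0" for n
    using that by (cases n) (auto simp: L_def)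
  have inv: "(\<lambda>n. 1 / sqrt (L n)) \<longlonglongrightarrow> 0"
    unfolding L_def by real_asymp
  have alpha_bounds: "\<forall>\<^sub>F n in sequentially. 1 \<le> alpha n \<and> alpha n \<le> real n"
    unfolding alpha_def by (intro eventually_conj; real_asymp)
  have z1: "norm (1 + z n) \<le> 1" for n by (simp add: z_def)
  have z_le: "norm (z n) \<le> \<bar>t\<bar> * \<bar>1 / sqrt (L n)\<bar>" for n
    using norm_iexp_minus_one_le[of "t / sqrt (L n)"] by (simp add: z_def abs_divide)
  have z2: "norm (z n) \<le> 2" for n
    using norm_triangle_ineq4[of "iexp (t / sqrt (L n))" 1] by (simp add: z_def)
  have finA: "finite (A n)" for n unfolding A_def by (rule finite_primes_le)
  have \<mu>_eq: "\<mu> n = (\<Sum>p\<in>A n. 1 / real p)" for n by (simp add: \<mu>_def A_def prime_recip_sum_def)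
  have \<mu>0: "\<mu> n \<ge> 0" for n unfolding \<mu>_eq by (intro sum_nonneg) auto
  have \<mu>_close: "(\<lambda>n. (\<mu> n - L n) / sqrt (L n)) \<longlonglongrightarrow> 0"
    unfolding \<mu>_def L_def by (rule prime_recip_sum_alpha_asymp)

  \<comment> \<open>The multiples of a large prime \<open>p\<close> have mass at most
    \<open>(\<bar>C\<bar> + 1) / p\<close>: \<open>C / p\<close> from the hypothesis on large primes
    and \<open>1 / p\<close> from the uniform part. The factor \<open>norm (z n)\<close> supplies
    \<open>1 / sqrt (L n)\<close>.\<close>
  have XY: "(\<lambda>n. X n - Y n) \<longlonglongrightarrow> 0"
  proof (rule Lim_null_comparison)
    show "\<forall>\<^sub>F n in sequentially. norm (X n - Y n) \<le>
        \<bar>t\<bar> * (\<bar>C\<bar> + 1) * ((prime_recip_sum (real n) - prime_recip_sum (alpha n)) / sqrt (L n))"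
      using L_pos alpha_bounds
    proof eventually_elim
      case (elim n)
      have n: "n \<ge> 1" using n_pos elim by simp
      let ?B = "{p. prime p \<and> alpha n < real p \<and> p \<le> n}"
      have "norm (X n - Y n) \<le> norm (z n) * (\<Sum>p\<in>?B. \<Sum>m | m \<in> {1..n} \<and> p dvd m. P n m)"
        unfolding X_def Y_def A_def using distr[OF n] by (intro char_omega_drop_large_primes z1) auto
      also have "\<dots> \<le> norm (z n) * (\<Sum>p\<in>?B. (\<bar>C\<bar> + 1) * (1 / real p))"
      proof (intro mult_left_mono sum_mono)
        fix p assume p: "p \<in> ?B"
        then have "p > 0" by (simp add: prime_gt_0_nat)
        have "(\<Sum>m | m \<in> {1..n} \<and> p dvd m. P n m) \<le> C / real p + real (n div p) / real n"
          using large[of n p] p elim sum_eps_multiples[OF \<open>p > 0\<close>, of P n] by (simp add: L_def)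
        also have "\<dots> \<le> \<bar>C\<bar> / real p + 1 / real p"
          using div_real_bounds(1)[of p n] \<open>p > 0\<close> n by (intro add_mono divide_right_mono) auto
        finally show "(\<Sum>m | m \<in> {1..n} \<and> p dvd m. P n m) \<le> (\<bar>C\<bar> + 1) * (1 / real p)"
          by (simp add: add_divide_distrib)
      qed simp
      also have "\<dots> = norm (z n) * ((\<bar>C\<bar> + 1) * (prime_recip_sum (real n) - prime_recip_sum (alpha n)))"
        using elim by (simp add: sum_distrib_left[symmetric] prime_recip_sum_diff del: times_divide_eq_right)
      also have "\<dots> \<le> (\<bar>t\<bar> * \<bar>1 / sqrt (L n)\<bar>) * ((\<bar>C\<bar> + 1) * (prime_recip_sum (real n) - prime_recip_sum (alpha n)))"
      proof (intro mult_right_mono z_le mult_nonneg_nonneg)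
        show "0 \<le> prime_recip_sum (real n) - prime_recip_sum (alpha n)"
          using elim by (subst prime_recip_sum_diff[symmetric]) (auto intro: sum_nonneg)
      qed simp
      finally show ?case using elim by (simp add: mult_ac)
    qed
    have "(\<lambda>n. \<bar>t\<bar> * (\<bar>C\<bar> + 1) * ((prime_recip_sum (real n) - prime_recip_sum (alpha n)) / sqrt (L n)))
        \<longlonglongrightarrow> \<bar>t\<bar> * (\<bar>C\<bar> + 1) * 0"
      unfolding L_def by (intro tendsto_intros prime_recip_sum_above_alpha_asymp)
    then show "(\<lambda>n. \<bar>t\<bar> * (\<bar>C\<bar> + 1) * ((prime_recip_sum (real n) - prime_recip_sum (alpha n)) / sqrt (L n)))
        \<longlonglongrightarrow> 0" by simp
  qed

  have YQ: "(\<lambda>n. Y n - Q n) \<longlonglongrightarrow> 0"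
  proof (rule Lim_null_comparison)
    \<comment> \<open>\<open>y n\<close> bounds \<open>norm (z n) * \<mu> n\<close>. It is of order
      \<open>sqrt (L n)\<close> at most, which \<open>r n\<close>, about \<open>L n / 2\<close>,
      outgrows.\<close>
    define y where "y = (\<lambda>n. \<bar>t\<bar> * \<bar>1 / sqrt (L n)\<bar> * \<mu> n)"
    show "\<forall>\<^sub>F n in sequentially. norm (Y n - Q n) \<le>
        (\<bar>D\<bar> + 1) * exp 2 * (sqrt (real n) / real n) + 2 * (y n ^ r n / fact (r n))"
      using L_pos alpha_bounds
    proof eventually_elim
      case (elim n)
      have n: "n \<ge> 1" using n_pos elim by simp
      have "norm (Y n - Q n) \<le> (\<bar>D\<bar> + 1) / real n * (alpha n ^ r n * exp (norm (z n)))
          + 2 * ((norm (z n) * (\<Sum>p\<in>A n. 1 / real p)) ^ r n / fact (r n))"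
        unfolding Y_def Q_def
      proof (rule char_dvd_count_approx)
        show "real (card (A n)) \<le> alpha n"
          unfolding A_def using elim by (intro card_primes_le) auto
        fix T assume T: "T \<subseteq> A n"
        show "\<bar>(\<Sum>m | m \<in> {1..n} \<and> \<Prod>T dvd m. P n m) - (\<Prod>p\<in>T. 1 / real p)\<bar> \<le> (\<bar>D\<bar> + 1) / real n"
        \<comment> \<open>The hypothesis on small primes concerns nonempty sets; for the empty
          product the total mass is exactly 1.\<close>
        proof (cases "T = {}")
          case True
          have "(\<Sum>m | m \<in> {1..n} \<and> \<Prod>T dvd m. P n m) = (\<Sum>m=1..n. P n m)"
            using True by (intro sum.cong) auto
          then show ?thesis using True distr[OF n] by simp
        next
          case False
          have finT: "finite T" using T finA finite_subset by blast
          have pT: "\<forall>p\<in>T. prime p \<and> real p \<le> alpha n" using T by (auto simp: A_def)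
          then have d: "\<Prod>T > 0" by (intro prod_pos) (auto simp: prime_gt_0_nat)
          have "(\<Prod>p\<in>T. 1 / real p) = 1 / real (\<Prod>T)" by (simp add: prod_dividef)
          moreover have "0 \<le> (\<Sum>m | m \<in> {1..n} \<and> \<Prod>T dvd m. P n m) - real (n div \<Prod>T) / real n"
              "(\<Sum>m | m \<in> {1..n} \<and> \<Prod>T dvd m. P n m) - real (n div \<Prod>T) / real n \<le> D / real n"
            using small[of n T] elim(1) finT False pT unfolding sum_eps_multiples[OF d] L_def by auto
          \<comment> \<open>\<open>D\<close> comes from the hypothesis on small primes, the extra 1
            in \<open>\<bar>D\<bar> + 1\<close> from rounding \<open>n / \<Prod>T\<close>
            down.\<close>
          moreover have "D / real n \<le> \<bar>D\<bar> / real n" "0 \<le> \<bar>D\<bar> / real n" "0 \<le> 1 / real n"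
            by (auto intro: divide_right_mono)
          ultimately show ?thesis
            using div_real_bounds[OF d, of n] n unfolding add_divide_distrib by linarith
        qed
      qed (use distr[OF n] finA elim z1 in \<open>auto simp: A_def\<close>)
      also have "\<dots> \<le> (\<bar>D\<bar> + 1) / real n * (sqrt (real n) * exp 2) + 2 * (y n ^ r n / fact (r n))"
      proof (intro add_mono mult_left_mono mult_mono divide_right_mono power_mono)
        show "alpha n ^ r n \<le> sqrt (real n)"
          unfolding r_def L_def using elim n by (intro alpha_power_le) (auto simp: L_def)
        show "norm (z n) * (\<Sum>p\<in>A n. 1 / real p) \<le> y n"
          unfolding y_def \<mu>_eq[symmetric] by (intro mult_right_mono z_le \<mu>0)
      qed (use z2 \<mu>0[of n] in \<open>auto simp: \<mu>_eq\<close>)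
      finally show ?case by (simp add: mult_ac)
    qed
    have "(\<lambda>n. y n ^ r n / fact (r n)) \<longlonglongrightarrow> 0"
    proof (rule power_over_fact_tendsto_zero)
      show "filterlim r at_top sequentially"
        unfolding r_def L_def by real_asymp
      show "y n \<ge> 0" for n unfolding y_def using \<mu>0 by simp
      \<comment> \<open>This splits \<open>\<mu> n\<close> as \<open>(\<mu> n - L n) + L n\<close>,
        so that the known limit of the normalised difference applies.\<close>
      have "(\<lambda>n. \<bar>t\<bar> * ((\<mu> n - L n) / sqrt (L n) * (1 / real (r n)) + sqrt (L n) / real (r n)))
          \<longlonglongrightarrow> \<bar>t\<bar> * (0 * 0 + 0)"
      proof (intro tendsto_intros \<mu>_close)
        show "(\<lambda>n. 1 / real (r n)) \<longlonglongrightarrow> 0" "(\<lambda>n. sqrt (L n) / real (r n)) \<longlonglongrightarrow> 0"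
          unfolding r_def L_def by real_asymp+
      qed
      then have "(\<lambda>n. y n / real (r n)) \<longlonglongrightarrow> \<bar>t\<bar> * (0 * 0 + 0)"
      proof (rule Lim_transform_eventually)
        show "\<forall>\<^sub>F n in sequentially. \<bar>t\<bar> * ((\<mu> n - L n) / sqrt (L n) * (1 / real (r n)) + sqrt (L n) / real (r n))
            = y n / real (r n)"
          using L_pos
        proof eventually_elim
          case (elim n)
          have "(\<mu> n - L n) / sqrt (L n) * (1 / real (r n)) + sqrt (L n) / real (r n) =
              ((\<mu> n - L n) / sqrt (L n) + sqrt (L n)) / real (r n)"
            by (simp add: add_divide_distrib)
          also have "(\<mu> n - L n) / sqrt (L n) + sqrt (L n) = \<mu> n / sqrt (L n)"
            using elim by (simp add: field_simps)
          finally show ?case using elim by (simp add: y_def)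
        qed
      qed
      then show "(\<lambda>n. y n / real (r n)) \<longlonglongrightarrow> 0" by simp
    qed
    moreover have "(\<lambda>n. sqrt (real n) / real n) \<longlonglongrightarrow> 0" by real_asymp
    ultimately have "(\<lambda>n. (\<bar>D\<bar> + 1) * exp 2 * (sqrt (real n) / real n) + 2 * (y n ^ r n / fact (r n)))
        \<longlonglongrightarrow> (\<bar>D\<bar> + 1) * exp 2 * 0 + 2 * 0"
      by (intro tendsto_intros)
    then show "(\<lambda>n. (\<bar>D\<bar> + 1) * exp 2 * (sqrt (real n) / real n) + 2 * (y n ^ r n / fact (r n)))
        \<longlonglongrightarrow> 0" by simp
  qed

  have z_lim: "(\<lambda>n. norm (z n)) \<longlonglongrightarrow> 0"
  proof (rule Lim_null_comparison)
    show "\<forall>\<^sub>F n in sequentially. norm (norm (z n)) \<le> \<bar>t\<bar> * \<bar>1 / sqrt (L n)\<bar>"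
      using z_le by simp
    have "(\<lambda>n. \<bar>t\<bar> * \<bar>1 / sqrt (L n)\<bar>) \<longlonglongrightarrow> \<bar>t\<bar> * \<bar>0\<bar>"
      by (intro tendsto_intros inv)
    then show "(\<lambda>n. \<bar>t\<bar> * \<bar>1 / sqrt (L n)\<bar>) \<longlonglongrightarrow> 0" by simp
  qed
  have QU: "(\<lambda>n. Q n - U n) \<longlonglongrightarrow> 0"
  proof (rule Lim_null_comparison)
    have "\<forall>\<^sub>F n in sequentially. norm (z n) < 1"
      by (rule order_tendstoD[OF z_lim]) simp
    then show "\<forall>\<^sub>F n in sequentially. norm (Q n - U n) \<le> 2 * exp 1 * norm (z n) ^ 2"
    proof eventually_elim
      case (elim n)
      then show ?case
        unfolding Q_def U_def \<mu>_eq
        by (intro prod_one_plus_prime_recip_approx_exp finA z1) (auto simp: A_def)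
    qed
    have "(\<lambda>n. 2 * exp 1 * norm (z n) ^ 2) \<longlonglongrightarrow> 2 * exp 1 * 0 ^ 2"
      by (intro tendsto_intros z_lim)
    then show "(\<lambda>n. 2 * exp 1 * norm (z n) ^ 2) \<longlonglongrightarrow> 0" by simp
  qed

  have "(\<lambda>n. (X n - Y n) + (Y n - Q n) + (Q n - U n)) \<longlonglongrightarrow> 0 + 0 + 0"
    by (intro tendsto_intros XY YQ QU)
  then have XU: "(\<lambda>n. X n - U n) \<longlonglongrightarrow> 0" by simp
  have "(\<lambda>n. iexp (- t * sqrt (L n)) * (X n - U n)) \<longlonglongrightarrow> 0"
    by (rule Lim_null_comparison[OF _ tendsto_norm_zero[OF XU]]) (simp add: norm_mult)
  moreover have "(\<lambda>n. iexp (- t * sqrt (L n)) * U n) \<longlonglongrightarrow> of_real (exp (- (t ^ 2) / 2))"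
    unfolding U_def z_def by (rule poisson_char_tendsto_normal[OF L_lim \<mu>_close])
  ultimately have "(\<lambda>n. iexp (- t * sqrt (L n)) * (X n - U n) + iexp (- t * sqrt (L n)) * U n)
      \<longlonglongrightarrow> 0 + of_real (exp (- (t ^ 2) / 2))"
    by (rule tendsto_add)
  then have "(\<lambda>n. iexp (- t * sqrt (L n)) * X n) \<longlonglongrightarrow> of_real (exp (- (t ^ 2) / 2))"
    by (simp add: algebra_simps)
  then show ?thesis
  proof (rule Lim_transform_eventually)
    show "\<forall>\<^sub>F n in sequentially. iexp (- t * sqrt (L n)) * X n = (\<Sum>m=1..n. of_real (P n m) *
            iexp (t * ((real (omega m) - ln (ln (real n))) / sqrt (ln (ln (real n))))))"
      using L_pos
    proof eventually_elim
      case (elim n)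
      have "iexp (- t * sqrt (L n)) * (1 + z n) ^ omega m = iexp (t * ((real (omega m) - L n) / sqrt (L n)))" for m
      proof -
        have "(1 + z n) ^ omega m = iexp (real (omega m) * (t / sqrt (L n)))"
        proof -
          have "1 + z n = iexp (t / sqrt (L n))" by (simp add: z_def)
          moreover have "\<i> * complex_of_real (real (omega m) * (t / sqrt (L n))) =
              of_nat (omega m) * (\<i> * complex_of_real (t / sqrt (L n)))"
            by simp
          ultimately show ?thesis by (simp only: exp_of_nat_mult)
        qed
        then have "iexp (- t * sqrt (L n)) * (1 + z n) ^ omega m =
            iexp (- t * sqrt (L n) + real (omega m) * (t / sqrt (L n)))"
          by (simp only: exp_add[symmetric] of_real_add distrib_left)
        also have "- t * sqrt (L n) + real (omega m) * (t / sqrt (L n)) = t * ((real (omega m) - L n) / sqrt (L n))"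
          using elim by (simp add: field_simps)
        finally show ?thesis .
      qed
      then show ?case
        unfolding X_def sum_distrib_left L_def by (intro sum.cong refl) (metis mult.left_commute)
    qed
  qed
qed

theorem theorem2:
  fixes P :: "nat \<Rightarrow> nat \<Rightarrow> real"
  assumes distr: "\<And>n. n \<ge> 1 \<Longrightarrow> (\<forall>i\<in>{1..n}. P n i \<ge> 0) \<and> (\<Sum>i=1..n. P n i) = 1"
    and cond_i: "\<And>S. finite S \<Longrightarrow> S \<noteq> {} \<Longrightarrow> (\<forall>p\<in>S. prime p) \<Longrightarrow>
        (\<lambda>n. \<Sum>l=1..n div (\<Prod>S). eps P n (l * \<Prod>S)) \<longlonglongrightarrow> 0"
    and cond_ii: "\<exists>C::real. \<forall>n::nat. \<forall>p::nat. ln (ln (real n)) > 0 \<longrightarrow> prime p \<longrightarrow>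
        real p > alpha n \<longrightarrow> (\<Sum>l=1..n div p. eps P n (l * p)) \<le> C / real p"
    and cond_iii: "\<exists>D::real. \<forall>n::nat. \<forall>S::nat set. ln (ln (real n)) > 0 \<longrightarrow>
        finite S \<longrightarrow> S \<noteq> {} \<longrightarrow> (\<forall>p\<in>S. prime p \<and> real p \<le> alpha n) \<longrightarrow>
        0 \<le> (\<Sum>l=1..n div (\<Prod>S). eps P n (l * \<Prod>S)) \<and>
        (\<Sum>l=1..n div (\<Prod>S). eps P n (l * \<Prod>S)) \<le> D / real n"
  shows "\<forall>x::real. (\<lambda>n. \<Sum>m\<in>{m\<in>{1..n}. real (omega m) - ln (ln (real n))
            \<le> x * sqrt (ln (ln (real n)))}. P n m)
          \<longlonglongrightarrow> measure std_normal_distribution {..x}"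
proof
  fix x :: real
  let ?L = "\<lambda>n::nat. ln (ln (real n))"
  obtain C where C: "\<forall>n p. ?L n > 0 \<longrightarrow> prime p \<longrightarrow> real p > alpha n \<longrightarrow>
      (\<Sum>l=1..n div p. eps P n (l * p)) \<le> C / real p"
    using cond_ii by blast
  obtain D where D: "\<forall>n S. ?L n > 0 \<longrightarrow> finite S \<longrightarrow> S \<noteq> {} \<longrightarrow>
      (\<forall>p\<in>S. prime p \<and> real p \<le> alpha n) \<longrightarrow>
      0 \<le> (\<Sum>l=1..n div (\<Prod>S). eps P n (l * \<Prod>S)) \<and>
      (\<Sum>l=1..n div (\<Prod>S). eps P n (l * \<Prod>S)) \<le> D / real n"
    using cond_iii by blast
  have "(\<lambda>n. \<Sum>m | m \<in> {1..n} \<and> (real (omega m) - ?L n) / sqrt (?L n) \<le> x. P n m)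
      \<longlonglongrightarrow> measure std_normal_distribution {..x}"
  proof (rule weighted_cdf_tendsto[OF distr real_dist_normal_dist measure_std_normal_singleton])
    show "(\<lambda>n. \<Sum>m=1..n. of_real (P n m) * iexp (t * ((real (omega m) - ?L n) / sqrt (?L n))))
        \<longlonglongrightarrow> char std_normal_distribution t" for t
      unfolding char_std_normal_distribution
      by (rule omega_char_tendsto[OF distr, of C D]) (use C D in blast)+
  qed
  then show "(\<lambda>n. \<Sum>m\<in>{m\<in>{1..n}. real (omega m) - ?L n \<le> x * sqrt (?L n)}. P n m)
      \<longlonglongrightarrow> measure std_normal_distribution {..x}"
  \<comment> \<open>The two events coincide once \<open>?L n > 0\<close> permits division by
    \<open>sqrt (?L n)\<close>; the finitely many other \<open>n\<close> do not affect the
    limit.\<close>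
  proof (rule Lim_transform_eventually)
    have "\<forall>\<^sub>F n in sequentially. ?L n > 0"
      using filterlim_lnln_nat by (simp add: filterlim_at_top_dense)
    then show "\<forall>\<^sub>F n in sequentially.
        (\<Sum>m | m \<in> {1..n} \<and> (real (omega m) - ?L n) / sqrt (?L n) \<le> x. P n m) =
        (\<Sum>m\<in>{m\<in>{1..n}. real (omega m) - ?L n \<le> x * sqrt (?L n)}. P n m)"
      by eventually_elim (simp add: pos_divide_le_eq)
  qed
qed

end
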